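(* Let $A$ be a unital Banach algebra and let $a\in A$. (i) An element $b\in A$ is a normalized generalized inverse of $a$ if and only if $L_b$ is a normalized generalized inverse of $L_a$ in $L(A)$; likewise, $b$ is a normalized generalized inverse of $a$ if and only if $R_b$ is a normalized generalized inverse of $R_a$ in $L(A)$. (ii) Suppose that $a$ is regular and let $b\in A$. Then $b$ is the Moore-Penrose inverse of $a$ in $A$ if and only if $L_b$ is the Moore-Penrose inverse of $L_a$ in $L(A)$; likewise, $b$ is the Moore-Penrose inverse of $a$ in $A$ if and only if $R_b$ is the Moore-Penrose inverse of $R_a$ in $L(A)$. Moreover, in this case $(L_a)^{\dagger}=L_{a^{\dagger}}$ and $(R_a)^{\dagger}=R_{a^{\dagger}}$.
   Context: Scalars are complex. A unital Banach algebra $A$ has a unit $e$ with $\|e\|=1$. For a Banach space $X$, $L(X)$ is the Banach algebra of bounded linear operators on $X$ with the operator norm; $L(A)$ denotes the bounded linear operators on the Banach space $A$. For $a\in A$, $L_a,R_a\in L(A)$ are defined by $L_a(x)=ax$, $R_a(x)=xa$. An element $a$ is regular if there is $b\in A$ with $a=aba$. An element $b$ is a normalized generalized inverse of $a$ if $a=aba$ and $b=bab$. An element $h$ of a unital Banach algebra is hermitian if $\|\exp(ith)\|=1$ for all $t\in\mathbb{R}$. An element $x$ is the Moore-Penrose inverse of $a$, written $x=a^{\dagger}$, if $a=axa$, $x=xax$, and both $ax$ and $xa$ are hermitian (there is at most one such $x$). The Moore-Penrose inverse of an operator on $X$ is taken in the Banach algebra $L(X)$. *)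

theory Defs
  imports "HOL-Analysis.Analysis"
begin

section \<open>Complex Banach spaces and unital complex Banach algebras\<close>

class complex_normed_vector = real_normed_vector +
  fixes scaleC :: "complex \<Rightarrow> 'a \<Rightarrow> 'a"  (infixr \<open>*\<^sub>C\<close> 75)
  assumes scaleC_add_right: "c *\<^sub>C (x + y) = c *\<^sub>C x + c *\<^sub>C y"
    and scaleC_add_left: "(c + d) *\<^sub>C x = c *\<^sub>C x + d *\<^sub>C x"
    and scaleC_scaleC: "c *\<^sub>C d *\<^sub>C x = (c * d) *\<^sub>C x"
    and scaleC_of_real: "complex_of_real r *\<^sub>C x = r *\<^sub>R x"
    and norm_scaleC: "norm (c *\<^sub>C x) = cmod c * norm x"

class complex_banach = complex_normed_vector + banach

text \<open>The class \<^class>\<open>real_normed_algebra_1\<close> already contains the submultiplicativity of the norm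
  and \<^prop>\<open>norm 1 = 1\<close>.\<close>

class complex_banach_algebra_1 = complex_normed_vector + real_normed_algebra_1 + banach +
  assumes mult_scaleC_left: "(c *\<^sub>C x) * y = c *\<^sub>C (x * y)"
    and mult_scaleC_right: "x * (c *\<^sub>C y) = c *\<^sub>C (x * y)"
begin
subclass complex_banach ..
end


section \<open>The Banach algebra of bounded complex-linear operators on a space\<close>

text \<open>The type \<^typ>\<open>'a \<Rightarrow>\<^sub>L 'a\<close> consists of the real-linear bounded operators, normed by the operator
  norm; the complex-linear ones form a closed subalgebra of it.\<close>

typedef (overloaded) 'a bop =
  "{f :: 'a::complex_normed_vector \<Rightarrow>\<^sub>L 'a. \<forall>c x. blinfun_apply f (c *\<^sub>C x) = c *\<^sub>C blinfun_apply f x}"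
  morphisms blinfun_of_bop Abs_bop
  by (rule exI[of _ id_blinfun]) simp

setup_lifting type_definition_bop

lemma scaleC_minus_right: "c *\<^sub>C (- x) = - (c *\<^sub>C (x::'a::complex_normed_vector))"
  and scaleC_zero_right: "c *\<^sub>C (0::'a) = 0"
proof -
  show z: "c *\<^sub>C (0::'a) = 0" using scaleC_add_right[of c "0::'a" 0] by simp
  have "c *\<^sub>C (- x) + c *\<^sub>C x = 0" using scaleC_add_right[of c "- x" x] z by simp
  then show "c *\<^sub>C (- x) = - (c *\<^sub>C x)" by (rule eq_neg_iff_add_eq_0[THEN iffD2])
qed

lemma scaleC_diff_right: "c *\<^sub>C (x - y) = c *\<^sub>C x - c *\<^sub>C (y::'a::complex_normed_vector)"
  using scaleC_add_right[of c x "- y"] by (simp add: scaleC_minus_right)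

lemma scaleC_scaleR: "c *\<^sub>C r *\<^sub>R x = r *\<^sub>R c *\<^sub>C (x::'a::complex_normed_vector)"
  unfolding scaleC_of_real[symmetric] by (simp add: scaleC_scaleC mult.commute)

lemma bounded_linear_scaleC: "bounded_linear ((*\<^sub>C) c :: 'a \<Rightarrow> 'a::complex_normed_vector)"
  by (rule bounded_linear_intro[where K = "cmod c"])
     (auto simp: scaleC_add_right scaleC_scaleR norm_scaleC)

lemma norm_blinfun_scaleC_compose:
  fixes f :: "'a::complex_normed_vector \<Rightarrow>\<^sub>L 'a"
  shows "norm (Blinfun ((*\<^sub>C) c) o\<^sub>L f) = cmod c * norm f"
proof -
  have ap: "blinfun_apply (Blinfun ((*\<^sub>C) d)) y = d *\<^sub>C y" for d and y :: 'a
    by (simp add: bounded_linear_Blinfun_apply bounded_linear_scaleC)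
  have le: "norm (Blinfun ((*\<^sub>C) d) o\<^sub>L g) \<le> cmod d * norm g" for d and g :: "'a \<Rightarrow>\<^sub>L 'a"
  proof (rule norm_blinfun_bound)
    show "norm (blinfun_apply (Blinfun ((*\<^sub>C) d) o\<^sub>L g) x) \<le> cmod d * norm g * norm x" for x
      using mult_left_mono[OF norm_blinfun[of g x], of "cmod d"]
      by (simp add: ap norm_scaleC mult.assoc)
  qed simp
  show ?thesis
  proof (cases "c = 0")
    case True
    then show ?thesis using le[of 0 f] by simp
  next
    case False
    have "Blinfun ((*\<^sub>C) (inverse c)) o\<^sub>L (Blinfun ((*\<^sub>C) c) o\<^sub>L f) = f"
      using False scaleC_of_real[of 1] by (intro blinfun_eqI) (simp add: ap scaleC_scaleC)
    then have "norm f \<le> inverse (cmod c) * norm (Blinfun ((*\<^sub>C) c) o\<^sub>L f)"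
      using le[of "inverse c" "Blinfun ((*\<^sub>C) c) o\<^sub>L f"] by (simp add: norm_inverse)
    then have "cmod c * norm f \<le> norm (Blinfun ((*\<^sub>C) c) o\<^sub>L f)"
      using False by (simp add: field_simps)
    with le[of c f] show ?thesis by linarith
  qed
qed

instantiation bop :: (complex_normed_vector) complex_normed_vector
begin

lift_definition zero_bop :: "'a bop" is 0 by (simp add: scaleC_zero_right)
lift_definition plus_bop :: "'a bop \<Rightarrow> 'a bop \<Rightarrow> 'a bop" is "(+)"
  by (simp add: blinfun.add_left scaleC_add_right)
lift_definition minus_bop :: "'a bop \<Rightarrow> 'a bop \<Rightarrow> 'a bop" is "(-)"
  by (simp add: blinfun.diff_left scaleC_diff_right)
lift_definition uminus_bop :: "'a bop \<Rightarrow> 'a bop" is uminus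
  by (simp add: blinfun.minus_left scaleC_minus_right)
lift_definition scaleR_bop :: "real \<Rightarrow> 'a bop \<Rightarrow> 'a bop" is "(*\<^sub>R)"
  by (simp add: blinfun.scaleR_left scaleC_scaleR)
lift_definition scaleC_bop :: "complex \<Rightarrow> 'a bop \<Rightarrow> 'a bop" is
  "\<lambda>c f. Blinfun ((*\<^sub>C) c) o\<^sub>L f"
  by (simp add: bounded_linear_Blinfun_apply bounded_linear_scaleC scaleC_scaleC mult.commute)
lift_definition norm_bop :: "'a bop \<Rightarrow> real" is norm .

definition dist_bop :: "'a bop \<Rightarrow> 'a bop \<Rightarrow> real" where "dist_bop f g = norm (f - g)"
definition sgn_bop :: "'a bop \<Rightarrow> 'a bop" where "sgn_bop f = inverse (norm f) *\<^sub>R f"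
definition [code del]: "(uniformity :: ('a bop \<times> 'a bop) filter) =
  (INF e\<in>{0 <..}. principal {(f, g). dist f g < e})"
definition open_bop :: "'a bop set \<Rightarrow> bool" where [code del]:
  "open_bop S \<longleftrightarrow> (\<forall>f\<in>S. \<forall>\<^sub>F (f', g) in uniformity. f' = f \<longrightarrow> g \<in> S)"

instance
proof
  fix f g h :: "'a bop" and r s :: real and c d :: complex
  note simps = bounded_linear_Blinfun_apply bounded_linear_scaleC blinfun.add_left
    blinfun.scaleR_left
  show "f + g + h = f + (g + h)" by transfer simp
  show "f + g = g + f" by transfer simp
  show "0 + f = f" by transfer simp
  show "- f + f = 0" by transfer simp
  show "f - g = f + - g" by transfer simp
  show "r *\<^sub>R (f + g) = r *\<^sub>R f + r *\<^sub>R g" by transfer (simp add: scaleR_add_right)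
  show "(r + s) *\<^sub>R f = r *\<^sub>R f + s *\<^sub>R f" by transfer (simp add: scaleR_add_left)
  show "r *\<^sub>R s *\<^sub>R f = (r * s) *\<^sub>R f" by transfer simp
  show "1 *\<^sub>R f = f" by transfer simp
  show "dist f g = norm (f - g)" by (rule dist_bop_def)
  show "sgn f = inverse (norm f) *\<^sub>R f" by (rule sgn_bop_def)
  show "(uniformity :: ('a bop \<times> 'a bop) filter) =
      (INF e\<in>{0 <..}. principal {(f, g). dist f g < e})" by (rule uniformity_bop_def)
  show "open S \<longleftrightarrow> (\<forall>f\<in>S. \<forall>\<^sub>F (f', g) in uniformity. f' = f \<longrightarrow> g \<in> S)" for S :: "'a bop set"
    by (rule open_bop_def)
  show "norm f = 0 \<longleftrightarrow> f = 0" by transfer simp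
  show "norm (f + g) \<le> norm f + norm g" by transfer (rule norm_triangle_ineq)
  show "norm (r *\<^sub>R f) = \<bar>r\<bar> * norm f" by transfer simp
  show "c *\<^sub>C (f + g) = c *\<^sub>C f + c *\<^sub>C g"
    by transfer (rule blinfun_eqI, simp add: simps scaleC_add_right)
  show "(c + d) *\<^sub>C f = c *\<^sub>C f + d *\<^sub>C f"
    by transfer (rule blinfun_eqI, simp add: simps scaleC_add_left)
  show "c *\<^sub>C d *\<^sub>C f = (c * d) *\<^sub>C f"
    by transfer (rule blinfun_eqI, simp add: simps, rule scaleC_scaleC)
  show "complex_of_real r *\<^sub>C f = r *\<^sub>R f"
    by transfer (rule blinfun_eqI, simp add: simps scaleC_of_real)
  show "norm (c *\<^sub>C f) = cmod c * norm f"
    by transfer (rule norm_blinfun_scaleC_compose)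
qed

end

lemma norm_blinfun_of_bop: "norm (blinfun_of_bop f) = norm f"
  by transfer rule

lemma dist_blinfun_of_bop: "dist (blinfun_of_bop f) (blinfun_of_bop g) = dist f g"
  by (simp add: dist_norm norm_bop.rep_eq minus_bop.rep_eq)

instance bop :: (complex_banach) complex_banach
proof
  fix X :: "nat \<Rightarrow> 'a bop"
  assume "Cauchy X"
  then have "Cauchy (\<lambda>n. blinfun_of_bop (X n))"
    by (simp add: Cauchy_def dist_blinfun_of_bop)
  then obtain F where F: "(\<lambda>n. blinfun_of_bop (X n)) \<longlonglongrightarrow> F"
    using Cauchy_convergent_iff convergent_def by blast
  have lim: "(\<lambda>n. blinfun_apply (blinfun_of_bop (X n)) x) \<longlonglongrightarrow> blinfun_apply F x" for x
    by (intro blinfun.tendsto F tendsto_const)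
  have "blinfun_apply F (c *\<^sub>C x) = c *\<^sub>C blinfun_apply F x" for c x
  proof (rule LIMSEQ_unique[OF lim])
    have "(\<lambda>n. c *\<^sub>C blinfun_apply (blinfun_of_bop (X n)) x) \<longlonglongrightarrow> c *\<^sub>C blinfun_apply F x"
      by (rule bounded_linear.tendsto[OF bounded_linear_scaleC lim])
    then show "(\<lambda>n. blinfun_apply (blinfun_of_bop (X n)) (c *\<^sub>C x)) \<longlonglongrightarrow> c *\<^sub>C blinfun_apply F x"
      using blinfun_of_bop[of "X _"] by simp
  qed
  then have "blinfun_of_bop (Abs_bop F) = F"
    by (simp add: Abs_bop_inverse)
  with F have "X \<longlonglongrightarrow> Abs_bop F"
    by (simp add: tendsto_iff flip: dist_blinfun_of_bop)
  then show "convergent X"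
    by (rule convergentI)
qed

text \<open>A normed space without isolated points is the same as a nontrivial one; the norm of the identity
  operator is \<^term>\<open>1::real\<close> only in that case.  Every unital Banach algebra
  with \<^prop>\<open>norm 1 = 1\<close> satisfies this.\<close>

instantiation bop :: ("{complex_banach, perfect_space}") complex_banach_algebra_1
begin

lift_definition one_bop :: "'a bop" is id_blinfun by simp
lift_definition times_bop :: "'a bop \<Rightarrow> 'a bop \<Rightarrow> 'a bop" is "(o\<^sub>L)" by simp

instance
proof
  fix f g h :: "'a bop" and r :: real and c :: complex
  note simps = blinfun.add_left blinfun.add_right blinfun.scaleR_left blinfun.scaleR_right
    bounded_linear_Blinfun_apply bounded_linear_scaleC
  show "f * g * h = f * (g * h)" by transfer (auto intro: blinfun_eqI)
  show "(f + g) * h = f * h + g * h" by transfer (auto intro: blinfun_eqI simp: simps)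
  show "f * (g + h) = f * g + f * h" by transfer (auto intro: blinfun_eqI simp: simps)
  show "r *\<^sub>R f * g = r *\<^sub>R (f * g)" by transfer (auto intro: blinfun_eqI simp: simps)
  show "f * r *\<^sub>R g = r *\<^sub>R (f * g)" by transfer (auto intro: blinfun_eqI simp: simps)
  show "1 * f = f" by transfer (auto intro: blinfun_eqI)
  show "f * 1 = f" by transfer (auto intro: blinfun_eqI)
  show n1: "norm (1::'a bop) = 1" by transfer simp
  show "(0::'a bop) \<noteq> 1" by (metis n1 norm_zero zero_neq_one)
  show "norm (f * g) \<le> norm f * norm g" by transfer (rule norm_blinfun_compose)
  show "(c *\<^sub>C f) * g = c *\<^sub>C (f * g)" by transfer (auto intro: blinfun_eqI simp: simps)
  show "f * (c *\<^sub>C g) = c *\<^sub>C (f * g)" by transfer (auto intro: blinfun_eqI simp: simps)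
qed

end

lift_definition bop_apply :: "'a::complex_normed_vector bop \<Rightarrow> 'a \<Rightarrow> 'a" is blinfun_apply .

lemma bop_eqI: "(\<And>x. bop_apply f x = bop_apply g x) \<Longrightarrow> f = g"
  by transfer (rule blinfun_eqI)

lemma bop_apply_scaleC: "bop_apply (c *\<^sub>C f) x = c *\<^sub>C bop_apply f x"
  by transfer (simp add: bounded_linear_Blinfun_apply bounded_linear_scaleC)

lemma bop_apply_one: "bop_apply 1 x = x"
  by transfer simp

lemma bop_apply_times: "bop_apply (f * g) x = bop_apply f (bop_apply g x)"
  by transfer simp


section \<open>Multiplication operators\<close>

lift_definition left_mult :: "'a::complex_banach_algebra_1 \<Rightarrow> 'a bop" is blinfun_mult_right
  by (simp add: blinfun_mult_right.rep_eq mult_scaleC_right)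

lift_definition right_mult :: "'a::complex_banach_algebra_1 \<Rightarrow> 'a bop" is blinfun_mult_left
  by (simp add: mult_scaleC_left)

lemma bop_apply_left_mult: "bop_apply (left_mult a) x = a * x"
  by transfer (simp add: blinfun_mult_right.rep_eq)

lemma bop_apply_right_mult: "bop_apply (right_mult a) x = x * a"
  by transfer simp


section \<open>Generalized inverses\<close>

definition regular :: "'a::complex_banach_algebra_1 \<Rightarrow> bool"
  where "regular a \<longleftrightarrow> (\<exists>b. a = a * b * a)"

definition normalized_ginverse :: "'a::complex_banach_algebra_1 \<Rightarrow> 'a \<Rightarrow> bool"
  where "normalized_ginverse a b \<longleftrightarrow> a = a * b * a \<and> b = b * a * b"

definition hermitian :: "'a::complex_banach_algebra_1 \<Rightarrow> bool"
  where "hermitian h \<longleftrightarrow> (\<forall>t::real. norm (exp ((\<i> * complex_of_real t) *\<^sub>C h)) = 1)"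

definition is_mp_inverse :: "'a::complex_banach_algebra_1 \<Rightarrow> 'a \<Rightarrow> bool"
  where "is_mp_inverse a x \<longleftrightarrow>
    a = a * x * a \<and> x = x * a * x \<and> hermitian (a * x) \<and> hermitian (x * a)"

text \<open>Only meaningful for elements that have a Moore-Penrose inverse, which is then unique.\<close>

definition mp_inverse :: "'a::complex_banach_algebra_1 \<Rightarrow> 'a"
  where "mp_inverse a = (THE x. is_mp_inverse a x)"

end

theory Submission
  imports Defs
begin

text \<open>The maps \<open>x \<mapsto> L\<^sub>x\<close> and \<open>x \<mapsto> R\<^sub>x\<close> are unital complex-linear isometries, multiplicative and
  anti-multiplicative respectively; hence they preserve and reflect polynomial identities in one
  or two elements and, since they commute with the exponential, hermitian elements.

  The formulas for the Moore-Penrose inverses of \<open>L\<^sub>a\<close> and \<open>R\<^sub>a\<close> need uniqueness. If \<open>x\<close> and \<open>y\<close>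
  are Moore-Penrose inverses of \<open>a\<close>, then \<open>p = ax\<close> and \<open>q = ay\<close> are hermitian idempotents with
  \<open>pq = q\<close> and \<open>qp = p\<close>. A hermitian idempotent has \<open>exp (i\<pi>p) = 1 - 2p\<close>, so
  \<open>(1 - 2p)(1 - 2q) = 1 + 2(q - p)\<close> has norm at most one. As \<open>(q - p)\<^sup>2 = 0\<close>, its \<open>k\<close>-th power is
  \<open>1 + 2k(q - p)\<close>, which stays in the unit ball only if \<open>p = q\<close>. The same argument gives
  \<open>xa = ya\<close>, and then \<open>x = xax = xay = yay = y\<close>.\<close>

lemma scaleC_one: "1 *\<^sub>C x = (x::'a::complex_normed_vector)"
  using scaleC_of_real[of 1 x] by simp

lemma bounded_linear_scaleC_left: "bounded_linear (\<lambda>c. c *\<^sub>C (x::'a::complex_normed_vector))"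
proof (rule bounded_linear_intro[where K = "norm x"])
  show "(r *\<^sub>R c) *\<^sub>C x = r *\<^sub>R c *\<^sub>C x" for r c
    by (simp add: scaleR_conv_of_real scaleC_of_real flip: scaleC_scaleC)
qed (simp_all add: scaleC_add_left norm_scaleC)

lemma power_scaleC: "(c *\<^sub>C x) ^ n = c ^ n *\<^sub>C (x::'a::complex_banach_algebra_1) ^ n"
  by (induction n) (simp_all add: scaleC_one mult_scaleC_left mult_scaleC_right scaleC_scaleC mult.commute)

text \<open>Every positive power of \<open>p\<close> is \<open>p\<close>, so the exponential series
  is its constant term plus a scalar series times \<open>p\<close>.\<close>

lemma exp_scaleC_idempotent:
  fixes p :: "'a::complex_banach_algebra_1"
  assumes "p * p = p"
  shows "exp (c *\<^sub>C p) = 1 + (exp c - 1) *\<^sub>C p"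
proof -
  have pow: "p ^ Suc n = p" for n
    by (induction n) (simp_all add: assms)
  have "(\<lambda>n. c ^ n /\<^sub>R fact n) sums exp c"
    by (rule exp_converges)
  \<comment> \<open>The term of index 0 is split off because \<open>p ^ 0\<close> is
    \<open>1\<close>; it returns as the summand \<open>1\<close> at the end.\<close>
  then have "(\<lambda>n. c ^ Suc n /\<^sub>R fact (Suc n)) sums (exp c - 1)"
    by (subst sums_Suc_iff) simp
  then have "(\<lambda>n. (c ^ Suc n /\<^sub>R fact (Suc n)) *\<^sub>C p) sums ((exp c - 1) *\<^sub>C p)"
    by (rule bounded_linear.sums[OF bounded_linear_scaleC_left])
  moreover have "(c *\<^sub>C p) ^ Suc n /\<^sub>R fact (Suc n) = (c ^ Suc n /\<^sub>R fact (Suc n)) *\<^sub>C p" for n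
    unfolding power_scaleC pow
    by (rule linear_cmul[OF bounded_linear.linear[OF bounded_linear_scaleC_left], symmetric])
  ultimately have "(\<lambda>n. (c *\<^sub>C p) ^ Suc n /\<^sub>R fact (Suc n)) sums ((exp c - 1) *\<^sub>C p)"
    by simp
  then have "(\<lambda>n. (c *\<^sub>C p) ^ n /\<^sub>R fact n) sums ((exp c - 1) *\<^sub>C p + 1)"
    by (subst (asm) sums_Suc_iff) simp
  with exp_converges[of "c *\<^sub>C p"] show ?thesis
    by (simp add: sums_unique2 add.commute)
qed

lemma norm_reflection_hermitian_idempotent:
  fixes p :: "'a::complex_banach_algebra_1"
  assumes "hermitian p" "p * p = p"
  shows "norm (1 - 2 *\<^sub>R p) = 1"
proof -
  have "(- 2) *\<^sub>C p = - (2 *\<^sub>R p)"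
    using scaleC_of_real[of "- 2" p] by simp
  then have "exp ((\<i> * complex_of_real pi) *\<^sub>C p) = 1 - 2 *\<^sub>R p"
    by (simp add: exp_scaleC_idempotent[OF assms(2)] mult.commute[of \<i>])
  with assms(1) show ?thesis
    unfolding hermitian_def by metis
qed

lemma square_zero_perturbation_of_one:
  fixes n :: "'a::real_normed_algebra_1"
  assumes "n * n = 0" "norm (1 + n) \<le> 1"
  shows "n = 0"
proof (rule ccontr)
  assume "n \<noteq> 0"
  \<comment> \<open>If \<open>(1 + n) ^ k = 1 + k n\<close> lies in the unit ball, then
    \<open>k n\<close> has norm at most 2.\<close>
  then obtain k where k: "2 < real k * norm n"
    using reals_Archimedean3[of "norm n"] by auto
  have pow: "(1 + n) ^ m = 1 + real m *\<^sub>R n" for m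
    by (induction m) (simp_all add: algebra_simps assms(1))
  have "norm ((1 + n) ^ k) \<le> 1"
    using norm_power_ineq[of "1 + n" k] power_le_one[OF norm_ge_zero assms(2), of k] by linarith
  then show False
    using norm_triangle_ineq4[of "(1 + n) ^ k" 1] k by (simp add: pow)
qed

text \<open>The first alternative in \<open>absorb\<close> fits \<open>a * x\<close> and
  \<open>a * y\<close>, the second \<open>x * a\<close> and \<open>y * a\<close>.\<close>

lemma hermitian_idempotents_eqI:
  fixes p q :: "'a::complex_banach_algebra_1"
  assumes "hermitian p" "p * p = p" "hermitian q" "q * q = q"
    and absorb: "p * q = q \<and> q * p = p \<or> p * q = p \<and> q * p = q"
  shows "p = q"
proof -
  have bound: "norm ((1 - 2 *\<^sub>R p) * (1 - 2 *\<^sub>R q)) \<le> 1"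
    using norm_mult_ineq[of "1 - 2 *\<^sub>R p" "1 - 2 *\<^sub>R q"] assms(1-4)
    by (simp add: norm_reflection_hermitian_idempotent)
  have expand: "(1 - 2 *\<^sub>R p) * (1 - 2 *\<^sub>R q) = 1 - 2 *\<^sub>R p - 2 *\<^sub>R q + 4 *\<^sub>R (p * q)"
    by (simp add: algebra_simps)
  have double: "4 *\<^sub>R x = 2 *\<^sub>R x + 2 *\<^sub>R x" for x :: 'a
    by (simp flip: scaleR_add_left)
  \<comment> \<open>The term \<open>4 *\<^sub>R (p * q)\<close> cancels one of the two linear terms
    and reverses the sign of the other.\<close>
  from absorb obtain n where n: "(1 - 2 *\<^sub>R p) * (1 - 2 *\<^sub>R q) = 1 + 2 *\<^sub>R n"
    "n * n = 0" "n = q - p \<or> n = p - q"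
  proof
    assume "p * q = q \<and> q * p = p"
    then show thesis
      by (intro that[of "q - p"]) (simp_all add: expand assms algebra_simps double)
  next
    assume "p * q = p \<and> q * p = q"
    then show thesis
      by (intro that[of "p - q"]) (simp_all add: expand assms algebra_simps double)
  qed
  have "2 *\<^sub>R n = 0"
    by (rule square_zero_perturbation_of_one) (use n bound in simp_all)
  with n(3) show ?thesis
    by auto
qed

lemma is_mp_inverse_unique:
  assumes "is_mp_inverse a x" "is_mp_inverse a y"
  shows "x = y"
proof -
  have ginv: "a * x * a = a" "x * a * x = x" "a * y * a = a" "y * a * y = y"
    and herm: "hermitian (a * x)" "hermitian (x * a)" "hermitian (a * y)" "hermitian (y * a)"
    using assms unfolding is_mp_inverse_def by simp_all
  \<comment> \<open>The tail \<open>z\<close> lets these identities rewrite inside products nested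
    to the right.\<close>
  have absorb: "a * (x * (a * z)) = a * z" "a * (y * (a * z)) = a * z" for z
    using ginv by (simp_all flip: mult.assoc)
  have "a * x = a * y"
    by (rule hermitian_idempotents_eqI) (simp_all add: herm mult.assoc absorb)
  moreover have "x * a = y * a"
    by (rule hermitian_idempotents_eqI) (simp_all add: herm ginv[unfolded mult.assoc] mult.assoc)
  ultimately show ?thesis
    using ginv by (metis mult.assoc)
qed

lemma mp_inverse_eqI: "is_mp_inverse a x \<Longrightarrow> mp_inverse a = x"
  unfolding mp_inverse_def by (blast intro: is_mp_inverse_unique)

text \<open>The lower bound comes from evaluating at the unit, which has norm 1.\<close>

lemma norm_left_mult: "norm (left_mult a) = norm a"
proof (transfer, rule antisym)
  fix a :: 'a
  show "norm (blinfun_mult_right a) \<le> norm a"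
    by (rule norm_blinfun_bound) (simp_all add: blinfun_mult_right.rep_eq norm_mult_ineq)
  show "norm a \<le> norm (blinfun_mult_right a)"
    using norm_blinfun[of "blinfun_mult_right a" 1] by (simp add: blinfun_mult_right.rep_eq)
qed

lemma norm_right_mult: "norm (right_mult a) = norm a"
proof (transfer, rule antisym)
  fix a :: 'a
  show "norm (blinfun_mult_left a) \<le> norm a"
    by (rule norm_blinfun_bound) (simp_all add: mult.commute[of "norm a"] norm_mult_ineq)
  show "norm a \<le> norm (blinfun_mult_left a)"
    using norm_blinfun[of "blinfun_mult_left a" 1] by simp
qed

lemma left_mult_one: "left_mult 1 = 1"
  by (rule bop_eqI) (simp add: bop_apply_left_mult bop_apply_one)

lemma right_mult_one: "right_mult 1 = 1"
  by (rule bop_eqI) (simp add: bop_apply_right_mult bop_apply_one)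

lemma left_mult_times: "left_mult (a * b) = left_mult a * left_mult b"
  by (rule bop_eqI) (simp add: bop_apply_left_mult bop_apply_times mult.assoc)

lemma right_mult_times: "right_mult (a * b) = right_mult b * right_mult a"
  by (rule bop_eqI) (simp add: bop_apply_right_mult bop_apply_times mult.assoc)

lemma left_mult_scaleC: "left_mult (c *\<^sub>C a) = c *\<^sub>C left_mult a"
  by (rule bop_eqI) (simp add: bop_apply_left_mult bop_apply_scaleC mult_scaleC_left)

lemma right_mult_scaleC: "right_mult (c *\<^sub>C a) = c *\<^sub>C right_mult a"
  by (rule bop_eqI) (simp add: bop_apply_right_mult bop_apply_scaleC mult_scaleC_right)

lemma left_mult_eq_iff: "left_mult a = left_mult b \<longleftrightarrow> a = b"
  by (metis bop_apply_left_mult mult.right_neutral)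

lemma right_mult_eq_iff: "right_mult a = right_mult b \<longleftrightarrow> a = b"
  by (metis bop_apply_right_mult mult.left_neutral)

lemma bounded_linear_left_mult: "bounded_linear left_mult"
proof (rule bounded_linear_intro[where K = 1])
  show "left_mult (a + b) = left_mult a + left_mult b" for a b :: 'a
    by transfer (auto intro: blinfun_eqI simp: blinfun_mult_right.rep_eq blinfun.add_left distrib_right)
  show "left_mult (r *\<^sub>R a) = r *\<^sub>R left_mult a" for r and a :: 'a
    by (simp add: left_mult_scaleC flip: scaleC_of_real)
qed (simp add: norm_left_mult)

lemma bounded_linear_right_mult: "bounded_linear right_mult"
proof (rule bounded_linear_intro[where K = 1])
  show "right_mult (a + b) = right_mult a + right_mult b" for a b :: 'a
    by transfer (auto intro: blinfun_eqI simp: blinfun.add_left distrib_left)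
  show "right_mult (r *\<^sub>R a) = r *\<^sub>R right_mult a" for r and a :: 'a
    by (simp add: right_mult_scaleC flip: scaleC_of_real)
qed (simp add: norm_right_mult)

text \<open>A bounded linear map passes through the series term by term. Only powers of one element
  must be preserved, so anti-multiplicative maps qualify too.\<close>

lemma exp_bounded_linear_power:
  fixes f :: "'a::{real_normed_algebra_1,banach} \<Rightarrow> 'b::{real_normed_algebra_1,banach}"
  assumes "bounded_linear f" "\<And>n. f (x ^ n) = f x ^ n"
  shows "exp (f x) = f (exp x)"
proof -
  have "(\<lambda>n. f (x ^ n /\<^sub>R fact n)) sums f (exp x)"
    by (rule bounded_linear.sums[OF assms(1) exp_converges])
  then have "(\<lambda>n. f x ^ n /\<^sub>R fact n) sums f (exp x)"
    by (simp add: linear_cmul[OF bounded_linear.linear[OF assms(1)]] assms(2))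
  with exp_converges[of "f x"] show ?thesis
    by (rule sums_unique2)
qed

lemma exp_left_mult: "exp (left_mult a) = left_mult (exp a)"
proof (rule exp_bounded_linear_power[OF bounded_linear_left_mult])
  show "left_mult (a ^ n) = left_mult a ^ n" for n
    by (induction n) (simp_all add: left_mult_one left_mult_times)
qed

lemma exp_right_mult: "exp (right_mult a) = right_mult (exp a)"
proof (rule exp_bounded_linear_power[OF bounded_linear_right_mult])
  show "right_mult (a ^ n) = right_mult a ^ n" for n
    by (induction n) (simp_all add: right_mult_one right_mult_times power_commutes)
qed

lemma hermitian_left_mult_iff: "hermitian (left_mult h) \<longleftrightarrow> hermitian h"
  by (simp add: hermitian_def exp_left_mult norm_left_mult flip: left_mult_scaleC)

lemma hermitian_right_mult_iff: "hermitian (right_mult h) \<longleftrightarrow> hermitian h"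
  by (simp add: hermitian_def exp_right_mult norm_right_mult flip: right_mult_scaleC)

lemma normalized_ginverse_left_mult_iff:
  "normalized_ginverse (left_mult a) (left_mult b) \<longleftrightarrow> normalized_ginverse a b"
  by (simp add: normalized_ginverse_def left_mult_eq_iff flip: left_mult_times)

text \<open>Reversing the factors is harmless, since \<open>a * b * a\<close> and
  \<open>b * a * b\<close> are palindromes.\<close>

lemma normalized_ginverse_right_mult_iff:
  "normalized_ginverse (right_mult a) (right_mult b) \<longleftrightarrow> normalized_ginverse a b"
  by (simp add: normalized_ginverse_def right_mult_eq_iff mult.assoc flip: right_mult_times)

lemma is_mp_inverse_left_mult_iff:
  "is_mp_inverse (left_mult a) (left_mult b) \<longleftrightarrow> is_mp_inverse a b"
  by (simp add: is_mp_inverse_def left_mult_eq_iff hermitian_left_mult_iff flip: left_mult_times)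

text \<open>The reversal merely exchanges the two hermitian conditions.\<close>

lemma is_mp_inverse_right_mult_iff:
  "is_mp_inverse (right_mult a) (right_mult b) \<longleftrightarrow> is_mp_inverse a b"
  by (auto simp: is_mp_inverse_def right_mult_eq_iff hermitian_right_mult_iff mult.assoc
      simp flip: right_mult_times)

theorem theorem5:
  fixes a :: "'a::complex_banach_algebra_1"
  shows "(\<forall>b. (normalized_ginverse a b \<longleftrightarrow> normalized_ginverse (left_mult a) (left_mult b))
            \<and> (normalized_ginverse a b \<longleftrightarrow> normalized_ginverse (right_mult a) (right_mult b)))
    \<and> (regular a \<longrightarrow> (\<forall>b.
          (is_mp_inverse a b \<longleftrightarrow> is_mp_inverse (left_mult a) (left_mult b))
        \<and> (is_mp_inverse a b \<longleftrightarrow> is_mp_inverse (right_mult a) (right_mult b))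
        \<and> (is_mp_inverse a b \<longrightarrow>
              mp_inverse (left_mult a) = left_mult (mp_inverse a)
            \<and> mp_inverse (right_mult a) = right_mult (mp_inverse a))))"
proof -
  \<comment> \<open>Uniqueness is used both in the algebra itself and in its operator
    algebra.\<close>
  have "mp_inverse (left_mult a) = left_mult (mp_inverse a)
      \<and> mp_inverse (right_mult a) = right_mult (mp_inverse a)" if "is_mp_inverse a b" for b
    using that
    by (simp add: mp_inverse_eqI is_mp_inverse_left_mult_iff is_mp_inverse_right_mult_iff)
  then show ?thesis
    by (simp add: normalized_ginverse_left_mult_iff normalized_ginverse_right_mult_iff
      is_mp_inverse_left_mult_iff is_mp_inverse_right_mult_iff)
qed

end
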